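(* There exists a one-parameter family of topologically transitive piecewise-linear vector fields defined on the sphere $\mathbb{S}^2$.
   Context: $\mathbb{S}^2\subset\mathbb{R}^3$ is the unit sphere centered at the origin. **Piecewise-smooth vector field (PSVF).** A PSVF is a triple $(M,\Sigma,Z)$, usually denoted just by $Z$, where: (i) $M$ is a manifold (here $M=\mathbb{S}^2$); (ii) $\Sigma=\Sigma_1\sqcup\cdots\sqcup\Sigma_n$ (the switching manifold) is a finite union of pairwise disjoint simple smooth curves splitting $M$ into $n+1$ connected regions $R_1,\dots,R_{n+1}$, with $\Sigma_i=\gamma_i^{-1}(0)$ for smooth functions $\gamma_i:M\to\mathbb{R}$ having $0$ as a regular value; (iii) $Z=(X_1,\dots,X_{n+1})$ where each $X_k$ is a vector field of class $C^r$ on $M$, restricted to the closure of $R_k$. The regions are also called zones. **Piecewise-linear.** A PSVF on $\mathbb{S}^2$ is piecewise-linear if each $X_k$ is the restriction of a linear vector field $X_k(\mathbf{x})=A_k\mathbf{x}$ of $\mathbb{R}^3$ that is tangent to $\mathbb{S}^2$. **Regions of $\Sigma$.** Let $\Sigma_i$ be the common boundary of two regions $R_a$ and $R_b$, with $\nabla\gamma_i$ pointing into $R_a$ along $\Sigma_i$. Put $X_k.\gamma_i(p)=\langle X_k(p),\nabla\gamma_i(p)\rangle$. A point $p\in\Sigma_i$ is: a crossing point if $(X_a.\gamma_i(p))(X_b.\gamma_i(p))>0$; an escaping point if $X_a.\gamma_i(p)>0$ and $X_b.\gamma_i(p)<0$; a sliding point if $X_a.\gamma_i(p)<0$ and $X_b.\gamma_i(p)>0$;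 a tangency point if $X_a.\gamma_i(p)=0$ or $X_b.\gamma_i(p)=0$. The sets of all such points over all $i$ are denoted $\Sigma^c,\Sigma^e,\Sigma^s,\Sigma^t$. **Sliding (Filippov) vector field.** On $\Sigma^s\cup\Sigma^e$, $Z^\Sigma(p)$ is the unique convex combination of $X_a(p)$ and $X_b(p)$ tangent to $\Sigma_i$, i.e. $Z^\Sigma(p)=\frac{X_b.\gamma_i(p)\,X_a(p)-X_a.\gamma_i(p)\,X_b(p)}{X_b.\gamma_i(p)-X_a.\gamma_i(p)}$. If $p\in\Sigma^t$ and $\lim_{q\to p}Z^\Sigma(q)=L\neq0$ ($q\in\Sigma^s\cup\Sigma^e$), then $Z^\Sigma$ is extended to $p$ by $Z^\Sigma(p)=L$. **Trajectories.** A global trajectory of $Z$ is a continuous curve obtained by time-oriented concatenation of trajectories of the fields $X_k$ (each inside the closure of $R_k$) and/or of $Z^\Sigma$ (inside $\Sigma$). A Filippov trajectory (or orbit) is a global trajectory that is maximal, i.e. cannot be extended by any such concatenation. Trajectories through a given point need not be unique. **Topological transitivity.** $Z$ is (topologically) transitive if for any two non-empty open sets $U,V\subset M$ there is a Filippov trajectory connecting them, i.e. one visiting both $U$ and $V$. **One-parameter family.** A family $(Z_\theta)_{\theta\in I}$ of pairwise distinct PSVF indexed by a non-degenerate real interval $I$. *)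

theory Defs
  imports "HOL-Analysis.Analysis"
begin

abbreviation S2 :: "(real^3) set" where
  "S2 \<equiv> sphere 0 1"

text \<open>
  Differentiability classes on an open set: all iterated directional derivatives up to order
  \<open>k\<close> exist and are continuous.
\<close>

primrec Ck_on :: "nat \<Rightarrow> 'a::euclidean_space set \<Rightarrow> ('a \<Rightarrow> 'b::euclidean_space) \<Rightarrow> bool" where
  "Ck_on 0 U f \<longleftrightarrow> continuous_on U f"
| "Ck_on (Suc k) U f \<longleftrightarrow>
     (\<forall>x\<in>U. f differentiable (at x)) \<and> (\<forall>v. Ck_on k U (\<lambda>x. frechet_derivative f (at x) v))"

definition smooth_on :: "'a::euclidean_space set \<Rightarrow> ('a \<Rightarrow> 'b::euclidean_space) \<Rightarrow> bool" where
  "smooth_on U f \<longleftrightarrow> (\<forall>k. Ck_on k U f)"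

text \<open>
  Functions on the sphere are given by a differentiable extension to a neighbourhood of it. The
  choice of the extension affects neither the gradient \<open>sgrad\<close> at points of the sphere nor
  anything defined from it.
\<close>

definition Ck_S2 :: "nat \<Rightarrow> (real^3 \<Rightarrow> 'b::euclidean_space) \<Rightarrow> bool" where
  "Ck_S2 k f \<longleftrightarrow> (\<exists>U. open U \<and> S2 \<subseteq> U \<and> Ck_on k U f)"

definition smooth_S2 :: "(real^3 \<Rightarrow> 'b::euclidean_space) \<Rightarrow> bool" where
  "smooth_S2 f \<longleftrightarrow> (\<exists>U. open U \<and> S2 \<subseteq> U \<and> smooth_on U f)"

text \<open>The Riemannian gradient on the sphere: the tangential part of the ambient gradient.\<close>

definition sgrad :: "(real^3 \<Rightarrow> real) \<Rightarrow> real^3 \<Rightarrow> real^3" where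
  "sgrad f p = (let D = (THE D. GDERIV f p :> D) in D - (D \<bullet> p) *\<^sub>R p)"

text \<open>
  Regular level sets in the sphere are compact and without boundary, so a simple smooth curve
  occurring as one of them is closed.
\<close>

definition simple_smooth_curve :: "(real^3) set \<Rightarrow> bool" where
  "simple_smooth_curve C \<longleftrightarrow> (\<exists>c :: real \<Rightarrow> real^3.
     smooth_on UNIV c \<and> (\<forall>t. c (t + 1) = c t) \<and> inj_on c {0..<1} \<and>
     (\<forall>t. vector_derivative c (at t) \<noteq> 0) \<and> C = range c)"

text \<open>For a point \<open>p\<close> of the sphere and a vector \<open>v\<close> tangent to it at \<open>p\<close>; here
  \<open>t \<mapsto> sgn (p + t *\<^sub>R v)\<close> is a curve in the sphere with initial velocity \<open>v\<close>.\<close>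

definition points_into :: "real^3 \<Rightarrow> real^3 \<Rightarrow> (real^3) set \<Rightarrow> bool" where
  "points_into p v R \<longleftrightarrow> (\<exists>\<epsilon>>0. \<forall>t\<in>{0<..<\<epsilon>}. sgn (p + t *\<^sub>R v) \<in> R)"

text \<open>
  The curves are indexed by \<open>i < ncurves\<close>, the regions by \<open>k \<le> ncurves\<close>. The components
  \<open>pos\<close> and \<open>neg\<close> give, for each curve, the index \<open>a\<close> of the adjacent region into which the
  gradient points and the index \<open>b\<close> of the other adjacent region.
\<close>

record psvf =
  ncurves :: nat
  gam :: "nat \<Rightarrow> real^3 \<Rightarrow> real"
  region :: "nat \<Rightarrow> (real^3) set"
  field :: "nat \<Rightarrow> real^3 \<Rightarrow> real^3"
  pos :: "nat \<Rightarrow> nat"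
  neg :: "nat \<Rightarrow> nat"

definition curve :: "psvf \<Rightarrow> nat \<Rightarrow> (real^3) set" where
  "curve Z i = {p \<in> S2. gam Z i p = 0}"

definition switching :: "psvf \<Rightarrow> (real^3) set" where
  "switching Z = (\<Union>i<ncurves Z. curve Z i)"

definition is_psvf :: "nat \<Rightarrow> psvf \<Rightarrow> bool" where
  "is_psvf r Z \<longleftrightarrow>
     1 \<le> ncurves Z \<and>
     (\<forall>i<ncurves Z. smooth_S2 (gam Z i) \<and> (\<forall>p\<in>curve Z i. sgrad (gam Z i) p \<noteq> 0) \<and>
        simple_smooth_curve (curve Z i)) \<and>
     disjoint_family_on (curve Z) {..<ncurves Z} \<and>
     bij_betw (region Z) {..ncurves Z} (components (S2 - switching Z)) \<and>
     (\<forall>k\<le>ncurves Z. Ck_S2 r (field Z k) \<and> (\<forall>p\<in>S2. p \<bullet> field Z k p = 0)) \<and>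
     (\<forall>i<ncurves Z. pos Z i \<le> ncurves Z \<and> neg Z i \<le> ncurves Z \<and> pos Z i \<noteq> neg Z i \<and>
        closure (region Z (pos Z i)) \<inter> closure (region Z (neg Z i)) = curve Z i \<and>
        (\<forall>p\<in>curve Z i. points_into p (sgrad (gam Z i) p) (region Z (pos Z i))))"

definition piecewise_linear :: "psvf \<Rightarrow> bool" where
  "piecewise_linear Z \<longleftrightarrow> (\<forall>k\<le>ncurves Z. \<exists>A :: real^3^3.
     (\<forall>p\<in>S2. p \<bullet> (A *v p) = 0) \<and> (\<forall>p\<in>S2. field Z k p = A *v p))"

text \<open>
  Equality of the switching manifolds and of the fields on the closures of the regions,
  disregarding the numbering, the defining functions and the values of a field off its region.
\<close>

definition same_psvf :: "psvf \<Rightarrow> psvf \<Rightarrow> bool" where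
  "same_psvf Z W \<longleftrightarrow> switching Z = switching W \<and>
     (\<forall>k\<le>ncurves Z. \<exists>j\<le>ncurves W. region Z k = region W j \<and>
        (\<forall>p\<in>closure (region Z k). field Z k p = field W j p))"

definition lie :: "psvf \<Rightarrow> nat \<Rightarrow> nat \<Rightarrow> real^3 \<Rightarrow> real" where
  "lie Z k i p = field Z k p \<bullet> sgrad (gam Z i) p"

definition escaping :: "psvf \<Rightarrow> (real^3) set" where
  "escaping Z = {p. \<exists>i<ncurves Z. p \<in> curve Z i \<and> lie Z (pos Z i) i p > 0 \<and> lie Z (neg Z i) i p < 0}"

definition sliding :: "psvf \<Rightarrow> (real^3) set" where
  "sliding Z = {p. \<exists>i<ncurves Z. p \<in> curve Z i \<and> lie Z (pos Z i) i p < 0 \<and> lie Z (neg Z i) i p > 0}"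

definition tangency :: "psvf \<Rightarrow> (real^3) set" where
  "tangency Z = {p. \<exists>i<ncurves Z. p \<in> curve Z i \<and> (lie Z (pos Z i) i p = 0 \<or> lie Z (neg Z i) i p = 0)}"

definition curve_index :: "psvf \<Rightarrow> real^3 \<Rightarrow> nat" where
  "curve_index Z p = (THE i. i < ncurves Z \<and> p \<in> curve Z i)"

text \<open>The Filippov vector field on the sliding and escaping points.\<close>

definition filippov_field :: "psvf \<Rightarrow> real^3 \<Rightarrow> real^3" where
  "filippov_field Z p =
     (let i = curve_index Z p; a = pos Z i; b = neg Z i
      in (1 / (lie Z b i p - lie Z a i p)) *\<^sub>R (lie Z b i p *\<^sub>R field Z a p - lie Z a i p *\<^sub>R field Z b p))"

text \<open>
  Its extension to tangency points. The limit-point condition is needed because otherwise every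
  vector would be a limit.
\<close>

definition extends_to :: "psvf \<Rightarrow> real^3 \<Rightarrow> real^3 \<Rightarrow> bool" where
  "extends_to Z p L \<longleftrightarrow> p \<in> tangency Z \<and> p islimpt (sliding Z \<union> escaping Z) \<and> L \<noteq> 0 \<and>
     (filippov_field Z \<longlongrightarrow> L) (at p within (sliding Z \<union> escaping Z))"

definition ZSigma_dom :: "psvf \<Rightarrow> (real^3) set" where
  "ZSigma_dom Z = sliding Z \<union> escaping Z \<union> {p. \<exists>L. extends_to Z p L}"

definition ZSigma :: "psvf \<Rightarrow> real^3 \<Rightarrow> real^3" where
  "ZSigma Z p = (if p \<in> sliding Z \<union> escaping Z then filippov_field Z p else (THE L. extends_to Z p L))"

definition solution_piece ::
  "(real^3 \<Rightarrow> real^3) \<Rightarrow> (real^3) set \<Rightarrow> (real \<Rightarrow> real^3) \<Rightarrow> real \<Rightarrow> real \<Rightarrow> bool" where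
  "solution_piece X D x s t \<longleftrightarrow>
     (\<forall>u\<in>{s..t}. x u \<in> D \<and> (x has_vector_derivative X (x u)) (at u within {s..t}))"

definition local_trajectory :: "psvf \<Rightarrow> (real \<Rightarrow> real^3) \<Rightarrow> real \<Rightarrow> real \<Rightarrow> bool" where
  "local_trajectory Z x s t \<longleftrightarrow>
     (\<exists>k\<le>ncurves Z. solution_piece (field Z k) (closure (region Z k)) x s t) \<or>
     solution_piece (ZSigma Z) (ZSigma_dom Z) x s t"

text \<open>
  A curve on a non-degenerate time interval \<open>T\<close> of any kind, only the values of \<open>x\<close> on \<open>T\<close> being
  relevant. The concatenation may be infinite, but is finite on compact subintervals of \<open>T\<close>.
\<close>

definition global_trajectory :: "psvf \<Rightarrow> real set \<Rightarrow> (real \<Rightarrow> real^3) \<Rightarrow> bool" where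
  "global_trajectory Z T x \<longleftrightarrow>
     is_interval T \<and> (\<exists>a\<in>T. \<exists>b\<in>T. a < b) \<and> continuous_on T x \<and> x ` T \<subseteq> S2 \<and>
     (\<forall>a\<in>T. \<forall>b\<in>T. a < b \<longrightarrow>
        (\<exists>(m::nat) \<tau>. \<tau> 0 = a \<and> \<tau> m = b \<and>
           (\<forall>j<m. \<tau> j < \<tau> (Suc j) \<and> local_trajectory Z x (\<tau> j) (\<tau> (Suc j)))))"

definition filippov_trajectory :: "psvf \<Rightarrow> real set \<Rightarrow> (real \<Rightarrow> real^3) \<Rightarrow> bool" where
  "filippov_trajectory Z T x \<longleftrightarrow> global_trajectory Z T x \<and>
     (\<forall>T' y. global_trajectory Z T' y \<and> T \<subseteq> T' \<and> (\<forall>t\<in>T. y t = x t) \<longrightarrow> T' = T)"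

definition transitive :: "psvf \<Rightarrow> bool" where
  "transitive Z \<longleftrightarrow>
     (\<forall>U V. openin (top_of_set S2) U \<and> U \<noteq> {} \<and> openin (top_of_set S2) V \<and> V \<noteq> {} \<longrightarrow>
        (\<exists>T x. filippov_trajectory Z T x \<and> (\<exists>s\<in>T. x s \<in> U) \<and> (\<exists>t\<in>T. x t \<in> V)))"

definition one_parameter_family :: "nat \<Rightarrow> real set \<Rightarrow> (real \<Rightarrow> psvf) \<Rightarrow> bool" where
  "one_parameter_family r I Z \<longleftrightarrow>
     is_interval I \<and> (\<exists>a\<in>I. \<exists>b\<in>I. a < b) \<and> (\<forall>\<theta>\<in>I. is_psvf r (Z \<theta>)) \<and>
     (\<forall>\<theta>\<in>I. \<forall>\<theta>'\<in>I. \<theta> \<noteq> \<theta>' \<longrightarrow> \<not> same_psvf (Z \<theta>) (Z \<theta>'))"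

end

theory Submission
  imports Defs
begin

text \<open>
  The sphere is switched along the two parallels at heights \<open>\<plusminus>h\<close>, and \<open>h \<in> (0, 1/2)\<close> is the
  parameter of the family. Both caps rotate about \<open>(-1, 0, 0)\<close>, the band between them about
  \<open>(3/5, 0, 4/5)\<close>. On each parallel the points with \<open>y \<noteq> 0\<close> are sliding on one side of the plane
  \<open>y = 0\<close> and escaping on the other, and the Filippov field is there the rotation with angular
  velocity \<open>(0, 0, 1/2)\<close>; it extends to the points with \<open>y = 0\<close>, so each parallel is a periodic
  orbit of sliding motion that can be left at its escaping points. Neither a cap nor the band
  contains a whole orbit of its own rotation in its interior, hence every point of the sphere is
  joined to a parallel forwards and backwards in time. The band orbits in the plane perpendicular
  to \<open>(3/5, 0, 4/5)\<close> join the two parallels in both directions. So any point can be reached from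
  any other.
\<close>

section \<open>Rotations\<close>

text \<open>Rodrigues' formula: for a unit vector \<open>w\<close> this is the rotation by the angle
  \<open>t\<close> about \<open>w\<close>, i.e. the flow of the linear field
  \<open>cross3 w\<close>.\<close>

definition rot :: "real^3 \<Rightarrow> real \<Rightarrow> real^3 \<Rightarrow> real^3" where
  "rot w t p = cos t *\<^sub>R p + sin t *\<^sub>R cross3 w p + ((1 - cos t) * (w \<bullet> p)) *\<^sub>R w"

lemma rot_0 [simp]: "rot w 0 p = p"
  by (simp add: rot_def)

lemma cross3_cross3_unit:
  assumes "norm w = 1"
  shows "cross3 w (cross3 w p) = (w \<bullet> p) *\<^sub>R w - p"
  using assms by (simp add: norm_eq_1 cross3_simps forall_3) algebra

lemma cross3_rot:
  assumes "norm w = 1"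
  shows "cross3 w (rot w t p) = - sin t *\<^sub>R p + cos t *\<^sub>R cross3 w p + (sin t * (w \<bullet> p)) *\<^sub>R w"
  unfolding rot_def cross_add_right cross_mult_right cross3_cross3_unit[OF assms]
  by (simp add: algebra_simps)

lemma norm_rot:
  assumes "norm w = 1" "norm p = 1"
  shows "norm (rot w t p) = 1"
proof -
  have w: "w \<bullet> w = 1" and p: "p \<bullet> p = 1" using assms by (simp_all add: norm_eq_1)
  have c: "cross3 w p \<bullet> cross3 w p = 1 - (w \<bullet> p)\<^sup>2"
    using norm_cross_dot[of w p] assms by (simp add: power2_norm_eq_inner)
  have pw: "p \<bullet> w = w \<bullet> p" by (rule inner_commute)
  have q: "p \<bullet> cross3 w p = 0" "cross3 w p \<bullet> p = 0" "w \<bullet> cross3 w p = 0" "cross3 w p \<bullet> w = 0"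
    by (rule dot_cross_self)+
  have "rot w t p \<bullet> rot w t p
      = (cos t)\<^sup>2 + (sin t)\<^sup>2 * (1 - (w \<bullet> p)\<^sup>2) + ((1 - cos t) * (w \<bullet> p))\<^sup>2
        + 2 * cos t * ((1 - cos t) * (w \<bullet> p)) * (w \<bullet> p)"
    unfolding rot_def inner_add_left inner_add_right inner_scaleR_left inner_scaleR_right
      p w c pw q by (simp add: power2_eq_square algebra_simps)
  also have "\<dots> = 1" using sin_cos_squared_add3[of t] by algebra
  finally show ?thesis by (simp add: norm_eq_1)
qed

text \<open>\<open>c\<close> is the angular speed, 1 in the zones and 1/2 on the switching circles;
  \<open>d\<close> is a phase that lets a path start at any time.\<close>

lemma rot_has_vector_derivative:
  assumes "norm w = 1"
  shows "((\<lambda>u. rot w (c * u + d) p) has_vector_derivative c *\<^sub>R cross3 w (rot w (c * u + d) p))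
    (at u within S)"
  unfolding cross3_rot[OF assms] unfolding rot_def
  by (auto intro!: derivative_eq_intros simp: algebra_simps)

lemma continuous_on_rot [continuous_intros]:
  fixes f :: "real \<Rightarrow> real"
  shows "continuous_on S f \<Longrightarrow> continuous_on S (\<lambda>u. rot w (f u) p)"
  unfolding rot_def by (intro continuous_intros)

lemma rot_3: "rot w t p $ 3
    = cos t * p $ 3 + sin t * (w $ 1 * p $ 2 - w $ 2 * p $ 1) + (1 - cos t) * (w \<bullet> p) * w $ 3"
  by (simp add: rot_def cross_components)

lemma norm_1_coords: "norm (p :: real^3) = 1 \<longleftrightarrow> (p $ 1)\<^sup>2 + (p $ 2)\<^sup>2 + (p $ 3)\<^sup>2 = 1"
  by (simp add: norm_eq_1 inner_vec_def sum_3 power2_eq_square)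

lemma rot_axis_3:
  "rot (axis 3 1) t p $ 1 = cos t * p $ 1 - sin t * p $ 2"
  "rot (axis 3 1) t p $ 2 = sin t * p $ 1 + cos t * p $ 2"
  "rot (axis 3 1) t p $ 3 = p $ 3"
proof -
  have "axis 3 1 \<bullet> p = p $ 3" by (simp add: inner_axis')
  then show "rot (axis 3 1) t p $ 1 = cos t * p $ 1 - sin t * p $ 2"
    "rot (axis 3 1) t p $ 2 = sin t * p $ 1 + cos t * p $ 2"
    "rot (axis 3 1) t p $ 3 = p $ 3"
    unfolding rot_def
    by (simp_all add: cross_components) (simp_all add: axis_def algebra_simps)
qed

section \<open>Zones of the sphere\<close>

definition zone :: "real set \<Rightarrow> (real^3) set" where
  "zone J = {p \<in> S2. p $ 3 \<in> J}"

text \<open>Longitude and height as coordinates. The map is continuous everywhere, also where a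
  whole line collapses to a pole, so connectedness and closures of zones can be read off from sets
  of heights.\<close>

definition spherical :: "real \<times> real \<Rightarrow> real^3" where
  "spherical q = (sqrt (1 - (snd q)\<^sup>2) * cos (fst q)) *\<^sub>R axis 1 1
     + (sqrt (1 - (snd q)\<^sup>2) * sin (fst q)) *\<^sub>R axis 2 1 + snd q *\<^sub>R axis 3 1"

lemma spherical_components:
  "spherical q $ 1 = sqrt (1 - (snd q)\<^sup>2) * cos (fst q)"
  "spherical q $ 2 = sqrt (1 - (snd q)\<^sup>2) * sin (fst q)"
  "spherical q $ 3 = snd q"
  by (simp_all add: spherical_def axis_def)

lemma S2_polar:
  assumes "p \<in> S2"
  shows "\<exists>t. 0 \<le> t \<and> t < 2 * pi \<and> p = spherical (t, p $ 3)"
proof -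
  have p: "(p $ 1)\<^sup>2 + (p $ 2)\<^sup>2 + (p $ 3)\<^sup>2 = 1"
    using assms by (simp add: norm_1_coords)
  define r where "r = sqrt (1 - (p $ 3)\<^sup>2)"
  have pp: "(p $ 1)\<^sup>2 + (p $ 2)\<^sup>2 = 1 - (p $ 3)\<^sup>2" using p by simp
  have r2: "r\<^sup>2 = (p $ 1)\<^sup>2 + (p $ 2)\<^sup>2"
    unfolding r_def pp[symmetric] by simp
  have "\<exists>t. 0 \<le> t \<and> t < 2 * pi \<and> p $ 1 = r * cos t \<and> p $ 2 = r * sin t"
  proof (cases "r = 0")
    case True
    then have "p $ 1 = 0 \<and> p $ 2 = 0" using r2 by (simp add: sum_power2_eq_zero_iff)
    then show ?thesis using True by (intro exI[of _ 0]) simp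
  next
    case False
    then have "r\<^sup>2 \<noteq> 0" by simp
    have "(p $ 1 / r)\<^sup>2 + (p $ 2 / r)\<^sup>2 = ((p $ 1)\<^sup>2 + (p $ 2)\<^sup>2) / r\<^sup>2"
      by (simp only: power_divide add_divide_distrib)
    also have "\<dots> = 1" by (simp only: r2[symmetric] divide_self[OF \<open>r\<^sup>2 \<noteq> 0\<close>])
    finally have "(p $ 1 / r)\<^sup>2 + (p $ 2 / r)\<^sup>2 = 1" .
    then obtain t where "0 \<le> t" "t < 2 * pi" "p $ 1 / r = cos t" "p $ 2 / r = sin t"
      using sincos_total_2pi by metis
    then show ?thesis using False by (intro exI[of _ t]) (auto simp: field_simps)
  qed
  then show ?thesis by (auto simp: vec_eq_iff forall_3 spherical_components r_def)
qed

lemma spherical_in_S2: "snd q \<in> {-1..1} \<Longrightarrow> spherical q \<in> S2"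
proof -
  assume "snd q \<in> {-1..1}"
  then have "(snd q)\<^sup>2 \<le> 1" by (simp add: abs_square_le_1 abs_le_iff)
  then have "(sqrt (1 - (snd q)\<^sup>2))\<^sup>2 = 1 - (snd q)\<^sup>2" by simp
  then show ?thesis using sin_cos_squared_add[of "fst q"]
    by (simp add: norm_1_coords spherical_components power_mult_distrib del: sin_cos_squared_add) algebra
qed

lemma S2_component_3: "p \<in> S2 \<Longrightarrow> p $ 3 \<in> {-1..1}"
  using component_le_norm_cart[of p 3] by (auto simp: abs_le_iff)

lemma continuous_on_spherical: "continuous_on S spherical"
  unfolding spherical_def by (intro continuous_intros)

lemma spherical_image:
  assumes "J \<subseteq> {-1..1}"
  shows "spherical ` (UNIV \<times> J) = zone J"
  unfolding zone_def using assms S2_polar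
  by (fastforce simp: spherical_components image_iff simp del: mem_sphere intro!: spherical_in_S2)

lemma connected_zone:
  assumes "connected J" "J \<subseteq> {-1..1}"
  shows "connected (zone J)"
  unfolding spherical_image[OF assms(2), symmetric]
  using assms(1) by (intro connected_continuous_image continuous_on_spherical connected_Times) auto

lemma closure_zone:
  assumes "J \<subseteq> {-1..1}"
  shows "closure (zone J) = zone (closure J)"
proof
  have "closed (zone (closure J))"
  proof -
    have "zone (closure J) = S2 \<inter> (\<lambda>p. p $ 3) -` closure J" by (auto simp: zone_def)
    then show ?thesis by (simp add: closed_Int closed_vimage continuous_on_component)
  qed
  moreover have "zone J \<subseteq> zone (closure J)" using closure_subset[of J] by (auto simp: zone_def)
  ultimately show "closure (zone J) \<subseteq> zone (closure J)" by (rule closure_minimal[rotated])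
  have "closure J \<subseteq> {-1..1}" using assms by (simp add: closure_minimal)
  \<comment> \<open>For this inclusion, continuity carries the closure of the strip into the closure
    of its image.\<close>
  then have "zone (closure J) = spherical ` closure (UNIV \<times> J)"
    by (simp add: spherical_image closure_Times)
  also have "\<dots> \<subseteq> closure (spherical ` (UNIV \<times> J))"
    by (intro image_closure_subset continuous_on_spherical closure_subset closed_closure)
  finally show "zone (closure J) \<subseteq> closure (zone J)" by (simp add: spherical_image assms)
qed

section \<open>Smooth functions\<close>

lemma Ck_on_const: "Ck_on k U (\<lambda>x. c)"
  by (induction k arbitrary: c) (auto simp: frechet_derivative_const)

lemma Ck_on_affine:
  assumes "bounded_linear f"
  shows "Ck_on k U (\<lambda>x. f x + c)"
proof (cases k)
  case 0
  then show ?thesis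
    by (simp add: continuous_on_add linear_continuous_on assms)
next
  case (Suc n)
  have d: "((\<lambda>x. f x + c) has_derivative f) (at x)" for x
    using bounded_linear.has_derivative[OF assms has_derivative_ident]
    by (rule has_derivative_add_const)
  show ?thesis
    using d by (auto simp: Suc differentiable_def frechet_derivative_at[symmetric, OF d] Ck_on_const)
qed

text \<open>This class of curves is closed under differentiation: a derivative has the same form
  with new \<open>a\<close>, \<open>b\<close> and with \<open>d = 0\<close>. The induction therefore
  keeps the three vectors arbitrary.\<close>

lemma smooth_on_trig:
  "smooth_on UNIV (\<lambda>t::real. cos (c * t) *\<^sub>R a + sin (c * t) *\<^sub>R b + d)" for a b d :: "real^3"
proof -
  have "Ck_on k UNIV (\<lambda>t::real. cos (c * t) *\<^sub>R a + sin (c * t) *\<^sub>R b + d)" for k and a b d :: "real^3"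
  proof (induction k arbitrary: a b d)
    case 0
    show ?case by (auto intro!: continuous_intros)
  next
    case (Suc k)
    have D: "((\<lambda>t. cos (c * t) *\<^sub>R a + sin (c * t) *\<^sub>R b + d) has_derivative
       (\<lambda>v. cos (c * t) *\<^sub>R ((c * v) *\<^sub>R b) + sin (c * t) *\<^sub>R ((- (c * v)) *\<^sub>R a) + 0)) (at t)" for t
      by (auto intro!: derivative_eq_intros simp: algebra_simps)
    show ?case unfolding Ck_on.simps
    proof (intro conjI ballI allI)
      fix v :: real
      show "Ck_on k UNIV (\<lambda>t. frechet_derivative
          (\<lambda>t. cos (c * t) *\<^sub>R a + sin (c * t) *\<^sub>R b + d) (at t) v)"
        using Suc.IH[of "(c * v) *\<^sub>R b" "(- (c * v)) *\<^sub>R a" 0]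
        by (simp only: frechet_derivative_at[OF D, symmetric])
    qed (use D in \<open>auto simp: differentiable_def\<close>)
  qed
  then show ?thesis by (simp add: smooth_on_def)
qed

lemma circle_simple_smooth_curve:
  assumes "\<bar>z\<bar> < 1"
  shows "simple_smooth_curve (zone {z})"
proof -
  define r where "r = sqrt (1 - z\<^sup>2)"
  have r: "r > 0" using assms by (simp add: r_def abs_square_less_1)
  define c :: "real \<Rightarrow> real^3" where
    "c = (\<lambda>t. cos (2 * pi * t) *\<^sub>R (r *\<^sub>R axis 1 1) + sin (2 * pi * t) *\<^sub>R (r *\<^sub>R axis 2 1) + z *\<^sub>R axis 3 1)"
  have c: "c t $ 1 = r * cos (2 * pi * t)" "c t $ 2 = r * sin (2 * pi * t)" "c t $ 3 = z" for t
    by (simp_all add: c_def axis_def)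
  have cs: "c t = spherical (2 * pi * t, z)" for t
    by (simp add: vec_eq_iff forall_3 c spherical_components r_def)
  have "inj_on c {0..<1}"
  proof (rule inj_onI)
    fix s t assume st: "s \<in> {0..<1}" "t \<in> {0..<1}" and "c s = c t"
    then have "r * cos (2 * pi * s) = r * cos (2 * pi * t)" "r * sin (2 * pi * s) = r * sin (2 * pi * t)"
      using c by metis+
    then have "cos (2 * pi * s) = cos (2 * pi * t) \<and> sin (2 * pi * s) = sin (2 * pi * t)"
      using r by simp
    then obtain n :: int where "2 * pi * s = 2 * pi * t + 2 * pi * n"
      using sin_cos_eq_iff by (metis mult.commute mult.left_commute)
    then have "2 * pi * s = 2 * pi * (t + n)" by (simp add: algebra_simps)
    then have n: "s = t + n" by simp
    then have "real_of_int n < 1" "real_of_int n > -1" using st by auto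
    then have "n = 0" by linarith
    then show "s = t" using n by simp
  qed
  moreover have "vector_derivative c (at t) \<noteq> 0" for t
  proof -
    define D where "D = (- (2 * pi) * sin (2 * pi * t)) *\<^sub>R (r *\<^sub>R axis 1 1) + (2 * pi * cos (2 * pi * t)) *\<^sub>R (r *\<^sub>R axis 2 1 :: real^3)"
    have "(c has_vector_derivative D) (at t)"
      unfolding c_def D_def by (auto intro!: derivative_eq_intros simp: algebra_simps)
    moreover have "D \<noteq> 0"
    proof
      assume "D = 0"
      then have "D $ 1 = 0" "D $ 2 = 0" by simp_all
      then have "sin (2 * pi * t) = 0" "cos (2 * pi * t) = 0" using r by (auto simp: D_def axis_def)
      then show False using sin_cos_squared_add[of "2 * pi * t"] by simp
    qed
    ultimately show ?thesis by (simp add: vector_derivative_at)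
  qed
  moreover have "zone {z} = range c"
  proof
    have "p \<in> range c" if pz: "p \<in> zone {z}" for p
    proof -
      obtain t where "p = spherical (t, p $ 3)" using pz S2_polar[of p] by (auto simp: zone_def)
      then have "p = c (t / (2 * pi))" using pz by (simp add: cs zone_def)
      then show ?thesis by blast
    qed
    then show "zone {z} \<subseteq> range c" by blast
    show "range c \<subseteq> zone {z}"
      using spherical_in_S2[of "(_, z)"] assms
      by (auto simp: cs zone_def spherical_components abs_less_iff)
  qed
  moreover have "c (t + 1) = c t" for t
    by (simp add: c_def distrib_left)
  moreover have "smooth_on UNIV c"
    unfolding c_def by (rule smooth_on_trig)
  ultimately show ?thesis unfolding simple_smooth_curve_def by blast
qed

section \<open>Concatenation of trajectories\<close>

lemma solution_piece_cong:
  assumes "solution_piece X D x s t" "\<And>u. u \<in> {s..t} \<Longrightarrow> y u = x u"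
  shows "solution_piece X D y s t"
  using assms unfolding solution_piece_def by (auto intro: has_vector_derivative_transform)

lemma solution_piece_subinterval:
  assumes "solution_piece X D x s t" "{s'..t'} \<subseteq> {s..t}"
  shows "solution_piece X D x s' t'"
  using assms unfolding solution_piece_def
  by (meson has_vector_derivative_within_subset subset_iff)

lemma local_trajectory_cong:
  "local_trajectory Z x s t \<Longrightarrow> (\<And>u. u \<in> {s..t} \<Longrightarrow> y u = x u) \<Longrightarrow> local_trajectory Z y s t"
  unfolding local_trajectory_def by (meson solution_piece_cong)

lemma local_trajectory_subinterval:
  "local_trajectory Z x s t \<Longrightarrow> {s'..t'} \<subseteq> {s..t} \<Longrightarrow> local_trajectory Z x s' t'"
  unfolding local_trajectory_def by (meson solution_piece_subinterval)

lemma continuous_on_local_trajectory: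
  "local_trajectory Z x s t \<Longrightarrow> continuous_on {s..t} x"
  unfolding local_trajectory_def solution_piece_def
  by (meson continuous_on_eq_continuous_within has_vector_derivative_continuous)

inductive conc :: "psvf \<Rightarrow> (real \<Rightarrow> real^3) \<Rightarrow> real \<Rightarrow> real \<Rightarrow> bool" for Z x a where
  conc_refl: "conc Z x a a"
| conc_step: "conc Z x a b \<Longrightarrow> b < c \<Longrightarrow> local_trajectory Z x b c \<Longrightarrow> conc Z x a c"

lemma conc_le: "conc Z x a b \<Longrightarrow> a \<le> b"
  by (induction rule: conc.induct) auto

lemma conc_single: "a \<le> b \<Longrightarrow> local_trajectory Z x a b \<Longrightarrow> conc Z x a b"
  by (cases "a = b") (auto intro: conc.intros)

lemma conc_trans:
  assumes "conc Z x b c" "conc Z x a b"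
  shows "conc Z x a c"
  using assms by (induction rule: conc.induct) (auto intro: conc.intros)

lemma conc_cong:
  assumes "conc Z x a b" "\<And>u. u \<in> {a..b} \<Longrightarrow> y u = x u"
  shows "conc Z y a b"
  using assms
proof (induction rule: conc.induct)
  case (conc_step b c)
  have "a \<le> b" using conc_step.hyps(1) by (rule conc_le)
  then have "local_trajectory Z y b c"
    using conc_step.prems by (intro local_trajectory_cong[OF conc_step.hyps(3)]) auto
  moreover have "conc Z y a b" using conc_step \<open>a \<le> b\<close> by auto
  ultimately show ?case using conc_step.hyps(2) by (auto intro: conc.intros)
qed (rule conc_refl)

text \<open>\<open>global_trajectory\<close> demands a partition between any two times; with this
  lemma a single long concatenation supplies all shorter ones.\<close>

lemma conc_subinterval:
  assumes "conc Z x a b" "a \<le> a'" "a' \<le> b'" "b' \<le> b"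
  shows "conc Z x a' b'"
  using assms
proof (induction arbitrary: a' b' rule: conc.induct)
  case conc_refl
  then have "a' = a" "b' = a" by auto
  then show ?case by (simp add: conc.conc_refl)
next
  case (conc_step b c)
  \<comment> \<open>The window lies before the last breakpoint \<open>b\<close>, inside the last
    piece, or across \<open>b\<close>.\<close>
  consider "b' \<le> b" | "b \<le> a'" | "a' < b" "b < b'" by linarith
  then show ?case
  proof cases
    case 1
    then show ?thesis using conc_step by auto
  next
    case 2
    then show ?thesis using conc_step
      by (auto intro!: conc_single local_trajectory_subinterval[OF conc_step.hyps(3)])
  next
    case 3
    then have "conc Z x a' b" using conc_step by auto
    moreover have "local_trajectory Z x b b'"
      using 3 conc_step by (auto intro!: local_trajectory_subinterval[OF conc_step.hyps(3)])
    ultimately show ?thesis using 3 by (auto intro: conc.conc_step)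
  qed
qed

lemma conc_partition:
  assumes "conc Z x a b"
  shows "\<exists>(m::nat) \<tau>. \<tau> 0 = a \<and> \<tau> m = b \<and>
    (\<forall>j<m. \<tau> j < \<tau> (Suc j) \<and> local_trajectory Z x (\<tau> j) (\<tau> (Suc j)))"
  using assms
proof (induction rule: conc.induct)
  case conc_refl
  show ?case by (rule exI[of _ 0]) auto
next
  case (conc_step b c)
  then obtain m \<tau> where "\<tau> 0 = a" "\<tau> m = b"
    "\<forall>j<m. \<tau> j < \<tau> (Suc j) \<and> local_trajectory Z x (\<tau> j) (\<tau> (Suc j))" by blast
  then show ?case using conc_step.hyps
    by (intro exI[of _ "Suc m"] exI[of _ "\<tau>(Suc m := c)"]) (auto simp: less_Suc_eq)
qed

lemma continuous_on_conc:
  assumes "conc Z x a b"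
  shows "continuous_on {a..b} x"
  using assms
proof (induction rule: conc.induct)
  case (conc_step b c)
  have "{a..c} = {a..b} \<union> {b..c}" using conc_le[OF conc_step.hyps(1)] conc_step.hyps(2) by auto
  then show ?case
    using conc_step continuous_on_local_trajectory by (auto intro!: continuous_on_closed_Un)
qed auto

text \<open>Maximality is automatic for a trajectory on the whole time line, since no larger set of
  times exists.\<close>

lemma filippov_trajectory_UNIV:
  assumes conc: "\<And>a b. a < b \<Longrightarrow> conc Z x a b" and "range x \<subseteq> S2"
  shows "filippov_trajectory Z UNIV x"
proof -
  have "continuous_on UNIV x"
  proof (rule continuous_at_imp_continuous_on, rule ballI)
    fix t :: real
    have "continuous_on {t - 1..t + 1} x" by (rule continuous_on_conc[OF conc]) simp
    then show "isCont x t" by (rule continuous_on_interior) auto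
  qed
  moreover have "\<exists>a\<in>UNIV. \<exists>b\<in>UNIV. a < (b :: real)" using zero_less_one by blast
  ultimately have "global_trajectory Z UNIV x"
    using assms(2) conc_partition[OF conc] unfolding global_trajectory_def
    by (intro conjI ballI impI is_interval_univ)
  then show ?thesis unfolding filippov_trajectory_def by (simp add: top.extremum_unique)
qed

section \<open>Gluing of paths and reachability\<close>

definition glue :: "real \<Rightarrow> (real \<Rightarrow> real^3) \<Rightarrow> (real \<Rightarrow> real^3) \<Rightarrow> real \<Rightarrow> real^3" where
  "glue b x y = (\<lambda>u. if u \<le> b then x u else y u)"

lemma glue_left: "u \<le> b \<Longrightarrow> glue b x y u = x u"
  by (simp add: glue_def)

lemma glue_right: "x b = y b \<Longrightarrow> b \<le> u \<Longrightarrow> glue b x y u = y u"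
  by (auto simp: glue_def)

lemma conc_glue:
  assumes "conc Z x a b" "conc Z y b c" "x b = y b"
  shows "conc Z (glue b x y) a c"
proof (rule conc_trans)
  show "conc Z (glue b x y) b c"
    using assms(2) by (rule conc_cong) (simp add: glue_right assms(3))
  show "conc Z (glue b x y) a b"
    using assms(1) by (rule conc_cong) (simp add: glue_left)
qed

text \<open>The starting time \<open>a\<close> is quantified universally, so that composing paths needs no time shift.\<close>

definition reach :: "psvf \<Rightarrow> real^3 \<Rightarrow> real^3 \<Rightarrow> bool" where
  "reach Z p q \<longleftrightarrow> (\<forall>a. \<exists>b x. conc Z x a b \<and> x a = p \<and> x b = q)"

lemma reach_trans [trans]:
  assumes "reach Z p q" "reach Z q r"
  shows "reach Z p r"
  unfolding reach_def
proof
  fix a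
  obtain b x where x: "conc Z x a b" "x a = p" "x b = q"
    using assms(1)[unfolded reach_def, THEN spec, of a] by (elim exE conjE)
  obtain c y where y: "conc Z y b c" "y b = q" "y c = r"
    using assms(2)[unfolded reach_def, THEN spec, of b] by (elim exE conjE)
  have "conc Z (glue b x y) a c" using x y by (intro conc_glue) auto
  moreover have "glue b x y a = p" "glue b x y c = r"
    using x y conc_le[OF x(1)] conc_le[OF y(1)] by (auto simp: glue_left glue_right)
  ultimately show "\<exists>c z. conc Z z a c \<and> z a = p \<and> z c = r" by blast
qed

lemma reach_flow:
  assumes w: "norm w = 1" and k: "k \<le> ncurves Z" "field Z k = cross3 w"
    and "s \<le> t" and D: "\<And>u. s \<le> u \<Longrightarrow> u \<le> t \<Longrightarrow> rot w u p \<in> closure (region Z k)"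
  shows "reach Z (rot w s p) (rot w t p)"
  unfolding reach_def
proof
  fix a
  \<comment> \<open>The shift \<open>s - a\<close> places the orbit at angle \<open>s\<close> at
    time \<open>a\<close>; the factor 1 matches the form of
    \<open>rot_has_vector_derivative\<close>.\<close>
  let ?x = "\<lambda>u. rot w (1 * u + (s - a)) p"
  have "solution_piece (field Z k) (closure (region Z k)) ?x a (a + (t - s))"
    unfolding solution_piece_def k(2)
  proof (intro ballI conjI)
    fix u assume "u \<in> {a..a + (t - s)}"
    then show "?x u \<in> closure (region Z k)" by (intro D) auto
    show "(?x has_vector_derivative cross3 w (?x u)) (at u within {a..a + (t - s)})"
      using rot_has_vector_derivative[OF w, of 1] by (simp only: scaleR_one)
  qed
  then have "local_trajectory Z ?x a (a + (t - s))"
    using k(1) unfolding local_trajectory_def by blast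
  then have "conc Z ?x a (a + (t - s))"
    using \<open>s \<le> t\<close> by (intro conc_single) simp_all
  then show "\<exists>b x. conc Z x a b \<and> x a = rot w s p \<and> x b = rot w t p"
    by (intro exI[of _ "a + (t - s)"] exI[of _ ?x]) auto
qed

text \<open>The zero set is compact and non-empty, so it has a least element; a negative value
  before that would force a still earlier zero. Applied to the height along an orbit, this finds the
  time at which the orbit meets the boundary of its zone.\<close>

lemma first_zero:
  fixes f :: "real \<Rightarrow> real"
  assumes "continuous_on {0..T} f" "0 \<le> T" "0 \<le> f 0" "f T \<le> 0"
  shows "\<exists>t\<in>{0..T}. f t = 0 \<and> (\<forall>u\<in>{0..t}. 0 \<le> f u)"
proof -
  have cont: "continuous_on {0..u} f" if "u \<le> T" for u
    by (rule continuous_on_subset[OF assms(1)]) (use that in auto)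
  define A where "A = {0..T} \<inter> f -` {0}"
  have "closed A" unfolding A_def
    using assms(1) by (intro continuous_closed_preimage) auto
  then have "compact A" by (simp add: A_def compact_Int_closed Int_absorb1 compact_eq_bounded_closed bounded_Int)
  moreover have "A \<noteq> {}"
    using IVT2'[of f T 0 0] assms by (auto simp: A_def)
  ultimately obtain t where t: "t \<in> A" "\<And>s. s \<in> A \<Longrightarrow> t \<le> s"
    using compact_attains_inf[of A] by metis
  have "0 \<le> f u" if u: "u \<in> {0..t}" for u
  proof (rule ccontr)
    assume neg: "\<not> 0 \<le> f u"
    have "u \<le> T" using u t(1) by (auto simp: A_def)
    then obtain s where s: "0 \<le> s" "s \<le> u" "f s = 0"
      using IVT2'[of f u 0 0] neg assms(3) cont u by auto
    \<comment> \<open>Together with \<open>s \<le> u \<le> t\<close> this leaves only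
      \<open>s = u\<close>, a zero where \<open>f\<close> was assumed negative.\<close>
    then have "t \<le> s" using t(2)[of s] \<open>u \<le> T\<close> by (auto simp: A_def)
    then have "s = u" using s(2) u by auto
    then show False using s(3) neg by simp
  qed
  then show ?thesis using t(1) by (auto simp: A_def)
qed

section \<open>The family\<close>

definition cap_axis :: "real^3" where
  "cap_axis = - axis 1 1"

text \<open>The triple 3, 4, 5 gives a rational unit vector. Like \<open>cap_axis\<close> it lies in
  the plane \<open>y = 0\<close>, but with first component of opposite sign, which makes the two Lie
  derivatives on a parallel opposite multiples of \<open>y\<close>.\<close>

definition band_axis :: "real^3" where
  "band_axis = (3/5) *\<^sub>R axis 1 1 + (4/5) *\<^sub>R axis 3 1"

text \<open>The sign of the hemisphere: circle \<open>i\<close> lies at height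
  \<open>hemi i * h\<close>, so one computation serves both circles.\<close>

definition hemi :: "nat \<Rightarrow> real" where
  "hemi i = (if i = 0 then 1 else -1)"

text \<open>Regions 0 and 1 are the caps bounded by circles 0 and 1, region 2 is the band. Each
  \<open>gam\<close> grows towards the pole of its own cap, hence the choice of \<open>pos\<close>
  and \<open>neg\<close>.\<close>

definition two_circles :: "real \<Rightarrow> psvf" where
  "two_circles h = \<lparr>ncurves = 2,
     gam = \<lambda>i p. hemi i * p $ 3 - h,
     region = \<lambda>k. zone (if k = 0 then {h<..1} else if k = 1 then {-1..<-h} else {-h<..<h}),
     field = \<lambda>k. cross3 (if k < 2 then cap_axis else band_axis),
     pos = \<lambda>i. i, neg = \<lambda>i. 2\<rparr>"

lemma axis_components:
  "cap_axis $ 1 = -1" "cap_axis $ 2 = 0" "cap_axis $ 3 = 0"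
  "band_axis $ 1 = 3/5" "band_axis $ 2 = 0" "band_axis $ 3 = 4/5"
  by (simp_all add: cap_axis_def band_axis_def axis_def)

lemma norm_axes: "norm cap_axis = 1" "norm band_axis = 1"
  by (simp_all add: norm_1_coords axis_components power2_eq_square)

lemma inner_band_axis: "band_axis \<bullet> p = 3/5 * p $ 1 + 4/5 * p $ 3"
  by (simp add: inner_vec_def sum_3 axis_components)

lemma hemi_sq [simp]: "hemi i * hemi i = 1" "hemi i * (hemi i * x) = x"
  by (simp_all add: hemi_def)

lemma hemi_mult_eq: "hemi i * x = y \<longleftrightarrow> x = hemi i * y"
  by (auto simp: hemi_def)

lemma abs_hemi [simp]: "\<bar>hemi i * x\<bar> = \<bar>x\<bar>"
  by (simp add: hemi_def)

text \<open>The upper bound keeps the parallels below 3/5, a modulus of height that every orbit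
  about \<open>band_axis\<close> attains.\<close>

locale half_height =
  fixes h :: real
  assumes h: "0 < h" "h < 1/2"
begin

abbreviation "Z \<equiv> two_circles h"

lemma sel [simp]:
  "ncurves Z = 2" "gam Z i p = hemi i * p $ 3 - h" "pos Z i = i" "neg Z i = 2"
  "i < 2 \<Longrightarrow> field Z i = cross3 cap_axis" "field Z 2 = cross3 band_axis"
  by (simp_all add: two_circles_def)

lemma in_region_cap: "i < 2 \<Longrightarrow> p \<in> region Z i \<longleftrightarrow> p \<in> S2 \<and> h < hemi i * p $ 3"
  using S2_component_3[of p] by (auto simp: two_circles_def zone_def hemi_def)

lemma in_region_band: "p \<in> region Z 2 \<longleftrightarrow> p \<in> S2 \<and> \<bar>p $ 3\<bar> < h"
  by (auto simp: two_circles_def zone_def abs_less_iff)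

lemma closure_region:
  "closure (region Z k) = zone (if k = 0 then {h..1} else if k = 1 then {-1..-h} else {-h..h})"
proof -
  have "{h<..1} \<subseteq> {-1..1}" "{-1..<-h} \<subseteq> {-1..1}" "{-h<..<h} \<subseteq> {-1..1}" using h by auto
  then show ?thesis using h by (simp add: two_circles_def closure_zone)
qed

lemma in_closure_cap: "i < 2 \<Longrightarrow> p \<in> closure (region Z i) \<longleftrightarrow> p \<in> S2 \<and> h \<le> hemi i * p $ 3"
  using S2_component_3[of p] by (auto simp: closure_region zone_def hemi_def)

lemma in_closure_band: "p \<in> closure (region Z 2) \<longleftrightarrow> p \<in> S2 \<and> \<bar>p $ 3\<bar> \<le> h"
  by (auto simp: closure_region zone_def abs_le_iff)

lemma in_curve: "p \<in> curve Z i \<longleftrightarrow> p \<in> S2 \<and> hemi i * p $ 3 = h"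
  by (auto simp: curve_def)

lemma curve_eq_zone: "curve Z i = zone {hemi i * h}"
  by (auto simp: in_curve zone_def hemi_mult_eq)

lemma in_switching: "p \<in> switching Z \<longleftrightarrow> p \<in> S2 \<and> \<bar>p $ 3\<bar> = h"
proof -
  have "p \<in> switching Z \<longleftrightarrow> p \<in> curve Z 0 \<or> p \<in> curve Z 1"
    by (auto simp: switching_def less_2_cases_iff)
  then show ?thesis using h by (auto simp: in_curve hemi_def abs_if)
qed

lemma in_switching_curve: "p \<in> switching Z \<longleftrightarrow> (\<exists>i<2. p \<in> curve Z i)"
  by (auto simp: switching_def)

section \<open>Gradients, Lie derivatives and the sliding field\<close>

lemma gam_eq: "gam Z i = (\<lambda>p. hemi i * p $ 3 - h)"
  by (simp add: two_circles_def)

lemma bounded_linear_gam: "bounded_linear (\<lambda>p :: real^3. hemi i * p $ 3)"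
  by (intro bounded_linear_const_mult bounded_linear_vec_nth)

lemma sgrad_gam: "sgrad (gam Z i) p = hemi i *\<^sub>R (axis 3 1 - p $ 3 *\<^sub>R p)"
proof -
  have "(gam Z i has_derivative (\<lambda>v. hemi i * v $ 3)) (at p)"
    using has_derivative_diff[OF bounded_linear.has_derivative[OF bounded_linear_gam has_derivative_ident]
        has_derivative_const[of h]]
    by (simp add: gam_eq)
  then have "(gam Z i has_derivative (\<lambda>v. v \<bullet> (hemi i *\<^sub>R axis 3 1))) (at p)"
    by (simp add: inner_axis)
  then have G: "GDERIV (gam Z i) p :> hemi i *\<^sub>R axis 3 1" by (simp add: gderiv_def)
  have "(THE D. GDERIV (gam Z i) p :> D) = hemi i *\<^sub>R axis 3 1"
  proof (rule the_equality, rule G)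
    fix D assume "GDERIV (gam Z i) p :> D"
    then have "(\<lambda>v. v \<bullet> D) = (\<lambda>v. v \<bullet> (hemi i *\<^sub>R axis 3 1))"
      using G unfolding gderiv_def by (rule has_derivative_unique)
    then show "D = hemi i *\<^sub>R axis 3 1" by (simp only: fun_eq_iff vector_eq_ldot)
  qed
  then show ?thesis by (simp add: sgrad_def inner_axis' algebra_simps)
qed

text \<open>The radial part of the gradient drops out because \<open>cross3 w p\<close> is
  orthogonal to \<open>p\<close>. What remains is the third component of \<open>cross3 w p\<close>,
  which is \<open>w $ 1 * p $ 2\<close> as both axes have \<open>w $ 2 = 0\<close>.\<close>

lemma lie_cap: "i < 2 \<Longrightarrow> lie Z i i p = - (hemi i * p $ 2)"
  by (simp add: lie_def sgrad_gam inner_diff_right inner_axis dot_cross_self cross_components axis_components)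

lemma lie_band: "lie Z 2 i p = 3/5 * hemi i * p $ 2"
  by (simp add: lie_def sgrad_gam inner_diff_right inner_axis dot_cross_self cross_components axis_components)

lemma curve_index: "i < 2 \<Longrightarrow> p \<in> curve Z i \<Longrightarrow> curve_index Z p = i"
  unfolding curve_index_def using h
  by (intro the_equality) (auto simp: in_curve hemi_def less_2_cases_iff split: if_splits)

text \<open>The Lie derivatives from the two sides have opposite signs unless \<open>y = 0\<close>,
  so no point of the circles is a crossing point.\<close>

lemma sliding_escaping: "sliding Z \<union> escaping Z = {p \<in> switching Z. p $ 2 \<noteq> 0}"
proof -
  have "(lie Z i i p < 0 \<and> 0 < lie Z 2 i p) \<or> (0 < lie Z i i p \<and> lie Z 2 i p < 0) \<longleftrightarrow> p $ 2 \<noteq> 0"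
    if "i < 2" for i p
    using that by (auto simp: lie_cap lie_band hemi_def)
  then show ?thesis
    unfolding sliding_def escaping_def in_switching_curve sel by blast
qed

lemma tangency_iff: "p \<in> tangency Z \<longleftrightarrow> p \<in> switching Z \<and> p $ 2 = 0"
proof -
  have "lie Z i i p = 0 \<or> lie Z 2 i p = 0 \<longleftrightarrow> p $ 2 = 0" if "i < 2" for i
    using that by (auto simp: lie_cap lie_band hemi_def)
  then show ?thesis unfolding tangency_def in_switching_curve sel by blast
qed

lemma filippov_field_eq:
  assumes "p \<in> sliding Z \<union> escaping Z"
  shows "filippov_field Z p = (1/2) *\<^sub>R cross3 (axis 3 1) p"
proof -
  obtain i where i: "i < 2" "p \<in> curve Z i" and y: "p $ 2 \<noteq> 0"
    using assms unfolding sliding_escaping in_switching_curve by blast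
  have s: "hemi i \<noteq> 0" by (simp add: hemi_def)
  \<comment> \<open>With \<open>m = hemi i * p $ 2\<close> the Lie derivatives are
    \<open>3/5 * m\<close> on the band side and \<open>- m\<close> on the cap side; their difference
    is \<open>8/5 * m\<close>, and \<open>m\<close> cancels.\<close>
  have "filippov_field Z p = (1 / (8/5 * (hemi i * p $ 2))) *\<^sub>R
      ((hemi i * p $ 2) *\<^sub>R ((3/5) *\<^sub>R cross3 cap_axis p + cross3 band_axis p))"
    using i by (simp add: filippov_field_def Let_def curve_index lie_cap lie_band algebra_simps)
  also have "\<dots> = (5/8) *\<^sub>R ((3/5) *\<^sub>R cross3 cap_axis p + cross3 band_axis p)"
    using s y by simp
  \<comment> \<open>The weight 3/5 cancels the first components of the axes and leaves
    \<open>(0, 0, 4/5)\<close>; multiplying by 5/8 gives the angular velocity 1/2.\<close>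
  also have "\<dots> = (1/2) *\<^sub>R cross3 (axis 3 1) p"
    by (simp add: vec_eq_iff forall_3 cross_components axis_components) (simp add: axis_def)
  finally show ?thesis .
qed

text \<open>The circles avoid the poles, so a point with \<open>y = 0\<close> has
  \<open>x \<noteq> 0\<close>, and small rotations about the vertical axis move it along its circle
  to points with \<open>y \<noteq> 0\<close>.\<close>

lemma switching_islimpt:
  assumes "p \<in> switching Z" "p $ 2 = 0"
  shows "p islimpt (sliding Z \<union> escaping Z)"
  unfolding islimpt_approachable
proof (intro allI impI)
  fix e :: real assume "e > 0"
  let ?f = "\<lambda>t. rot (axis 3 1) t p"
  have p: "norm p = 1" "\<bar>p $ 3\<bar> = h" using assms by (auto simp: in_switching)
  then have "(p $ 1)\<^sup>2 = 1 - h\<^sup>2" using assms(2) by (simp add: norm_1_coords flip: p(2))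
  moreover have "h\<^sup>2 < 1" using h by (simp add: abs_square_less_1)
  ultimately have x: "p $ 1 \<noteq> 0" by auto
  have "continuous_on UNIV ?f" by (intro continuous_intros)
  then obtain d where "d > 0" and d: "\<And>t. dist t 0 < d \<Longrightarrow> dist (?f t) (?f 0) < e"
    using \<open>e > 0\<close> unfolding continuous_on_iff by (metis UNIV_I)
  \<comment> \<open>Half of \<open>d\<close> gives \<open>t < d\<close>; the bound 1 keeps
    \<open>t\<close> below \<open>pi\<close>, where the sine is positive.\<close>
  define t where "t = min (d / 2) 1"
  have t: "0 < t" "t \<le> 1" "t < d" using \<open>d > 0\<close> by (auto simp: t_def min_def)
  have "sin t > 0" using t pi_gt3 by (intro sin_gt_zero) auto
  then have y: "?f t $ 2 \<noteq> 0" using x assms(2) by (simp add: rot_axis_3)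
  have "?f t \<in> switching Z"
    using p norm_rot[of "axis 3 1" p t] unfolding in_switching by (simp add: rot_axis_3)
  then have "?f t \<in> sliding Z \<union> escaping Z" using y by (simp add: sliding_escaping)
  moreover have "?f t \<noteq> p" using y assms(2) by metis
  moreover have "dist (?f t) p < e" using d[of t] t by simp
  ultimately show "\<exists>x'\<in>sliding Z \<union> escaping Z. x' \<noteq> p \<and> dist x' p < e" by blast
qed

text \<open>The formula for the Filippov field is continuous across \<open>y = 0\<close>, so it also
  gives the limit there; the limit is non-zero since the circles avoid the poles. Hence sliding
  motion never stops on a circle.\<close>

lemma ZSigma_switching:
  assumes "p \<in> switching Z"
  shows "p \<in> ZSigma_dom Z \<and> ZSigma Z p = (1/2) *\<^sub>R cross3 (axis 3 1) p"
proof (cases "p $ 2 = 0")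
  case False
  then have "p \<in> sliding Z \<union> escaping Z" using assms by (simp add: sliding_escaping)
  then show ?thesis by (auto simp: ZSigma_dom_def ZSigma_def filippov_field_eq)
next
  case True
  let ?S = "sliding Z \<union> escaping Z" and ?L = "(1/2) *\<^sub>R cross3 (axis 3 1) p"
  have lim: "p islimpt ?S" using assms True by (rule switching_islimpt)
  have "continuous_on UNIV (\<lambda>q. (1/2) *\<^sub>R cross3 (axis 3 1) q)"
    by (intro continuous_intros continuous_on_cross)
  then have "((\<lambda>q. (1/2) *\<^sub>R cross3 (axis 3 1) q) \<longlongrightarrow> ?L) (at p within ?S)"
    by (meson UNIV_I continuous_on_def subset_UNIV tendsto_within_subset)
  then have tends: "(filippov_field Z \<longlongrightarrow> ?L) (at p within ?S)"
    by (rule Lim_transform_within[OF _ zero_less_one]) (simp add: filippov_field_eq)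
  have "?L \<noteq> 0"
  proof
    assume "?L = 0"
    then have "cross3 (axis 3 1) p $ 2 = 0" by simp
    then have "p $ 1 = 0" by (simp add: cross_components axis_def)
    then have "(p $ 3)\<^sup>2 = 1" using True assms by (simp add: in_switching norm_1_coords)
    then have "h\<^sup>2 = 1" using assms by (metis in_switching power2_abs)
    then show False using h by (simp add: power2_eq_1_iff)
  qed
  then have ext: "extends_to Z p ?L"
    using True assms lim tends by (simp add: extends_to_def tangency_iff)
  have "(THE L. extends_to Z p L) = ?L"
  proof (rule the_equality, rule ext)
    fix L assume "extends_to Z p L"
    then show "L = ?L"
      using tends lim unfolding extends_to_def by (metis tendsto_unique trivial_limit_within)
  qed
  moreover have "p \<notin> ?S" using True by (simp add: sliding_escaping)
  ultimately show ?thesis using ext by (auto simp: ZSigma_dom_def ZSigma_def)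
qed

subsection \<open>The axioms of a piecewise smooth vector field\<close>

lemma region_component: "k \<le> 2 \<Longrightarrow> region Z k \<in> components (S2 - switching Z)"
proof -
  assume k: "k \<le> 2"
  let ?J = "if k = 0 then {h<..1} else if k = 1 then {-1..<-h} else {-h<..<h}"
  have R: "region Z k = zone ?J" by (simp add: two_circles_def)
  have J: "?J \<subseteq> {-1..1}" using h by auto
  have conn: "connected (region Z k)" unfolding R using J by (intro connected_zone) auto
  \<comment> \<open>Sample heights, one in each of the three intervals.\<close>
  let ?z = "if k = 0 then 1 else if k = 1 then -1 else 0 :: real"
  have "spherical (0, ?z) \<in> region Z k"
    unfolding R spherical_image[OF J, symmetric] using h by auto
  then have ne: "region Z k \<noteq> {}" by blast
  have sub: "region Z k \<subseteq> S2 - switching Z"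
    using h by (auto simp: R zone_def in_switching)
  have max: "d = region Z k"
    if d: "d \<noteq> {}" "region Z k \<subseteq> d" "d \<subseteq> S2 - switching Z" "connected d" for d
  proof
    obtain p where p: "p \<in> region Z k" "p \<in> d" using ne d(2) by blast
    \<comment> \<open>Maximality: the heights of a connected set contain every height between two of
      them, so leaving the region would mean taking the value \<open>h\<close> or
      \<open>-h\<close>.\<close>
    have c: "connected ((\<lambda>p. p $ 3) ` d)"
      using d(4) by (intro connected_continuous_image continuous_intros)
    have "\<bar>q $ 3\<bar> \<noteq> h" if "q \<in> d" for q
      using d(3) that in_switching[of q] by blast
    then have noth: "h \<notin> (\<lambda>p. p $ 3) ` d" "-h \<notin> (\<lambda>p. p $ 3) ` d"
      using h by fastforce+
    show "d \<subseteq> region Z k"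
    proof
      fix q assume q: "q \<in> d"
      then have qS: "q \<in> S2" using d(3) by blast
      have "{p $ 3..q $ 3} \<subseteq> (\<lambda>p. p $ 3) ` d" "{q $ 3..p $ 3} \<subseteq> (\<lambda>p. p $ 3) ` d"
        using connected_contains_Icc[OF c] p q by blast+
      then have "h \<notin> {p $ 3..q $ 3}" "h \<notin> {q $ 3..p $ 3}" "-h \<notin> {p $ 3..q $ 3}" "-h \<notin> {q $ 3..p $ 3}"
        using noth by blast+
      then show "q \<in> region Z k"
        using p(1) qS S2_component_3[OF qS] h by (auto simp: R zone_def split: if_splits)
    qed
  qed (rule d(2))
  show ?thesis
    unfolding in_components_maximal using conn ne sub max by metis
qed

lemma bij_betw_region: "bij_betw (region Z) {..2} (components (S2 - switching Z))"
  unfolding bij_betw_def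
proof
  show "inj_on (region Z) {..2}"
  proof (rule inj_onI)
    fix j k assume jk: "j \<in> {..2::nat}" "k \<in> {..2}" "region Z j = region Z k"
    obtain p where "p \<in> region Z j"
      using region_component[of j] jk(1) in_components_nonempty by fastforce
    then have "p \<in> region Z j" "p \<in> region Z k" using jk(3) by auto
    then show "j = k" using jk(1,2) h
      by (auto simp: two_circles_def zone_def split: if_splits)
  qed
  show "region Z ` {..2} = components (S2 - switching Z)"
  proof
    show "region Z ` {..2} \<subseteq> components (S2 - switching Z)" using region_component by auto
    show "components (S2 - switching Z) \<subseteq> region Z ` {..2}"
    proof
      fix C assume C: "C \<in> components (S2 - switching Z)"
      then obtain p where p: "p \<in> C" using in_components_nonempty by blast
      then have pS: "p \<in> S2" "\<bar>p $ 3\<bar> \<noteq> h"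
        using in_components_subset[OF C] in_switching[of p] by blast+
      then have "p \<in> region Z 0 \<or> p \<in> region Z 1 \<or> p \<in> region Z 2"
        by (auto simp: in_region_cap in_region_band hemi_def)
      then obtain k where "k \<le> 2" "p \<in> region Z k"
        by (metis le_refl one_le_numeral zero_le_numeral zero_le)
      then have "C = region Z k"
        using components_eq[OF C region_component] p by blast
      then show "C \<in> region Z ` {..2}" using \<open>k \<le> 2\<close> by blast
    qed
  qed
qed

lemma sgrad_points_into:
  assumes i: "i < 2" and p: "p \<in> curve Z i"
  shows "points_into p (sgrad (gam Z i) p) (region Z i)"
  unfolding points_into_def
\<comment> \<open>The estimate holds for every \<open>t > 0\<close>; the radius 1 is an arbitrary
  choice.\<close>
proof (intro exI[of _ 1] conjI ballI)
  fix t :: real assume "t \<in> {0<..<1}"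
  then have t: "t > 0" by simp
  define v where "v = hemi i *\<^sub>R (axis 3 1 - p $ 3 *\<^sub>R p)"
  define q where "q = p + t *\<^sub>R v"
  have pp: "p \<bullet> p = 1" using p by (simp add: in_curve norm_eq_1)
  have z2: "p $ 3 * p $ 3 = h * h" using p by (auto simp: in_curve hemi_def)
  have q3: "hemi i * q $ 3 = h + t * (1 - h\<^sup>2)"
    using p z2 by (simp add: q_def v_def in_curve algebra_simps power2_eq_square)
  have pv: "p \<bullet> v = 0" using pp
    by (simp add: v_def inner_diff_right inner_axis)
  then have vp: "v \<bullet> p = 0" by (simp only: inner_commute)
  have vv: "v \<bullet> v = 1 - h\<^sup>2" using pp z2
    by (simp add: v_def inner_diff_right inner_diff_left inner_axis inner_axis' power2_eq_square)
  have qq: "(norm q)\<^sup>2 = 1 + t\<^sup>2 * (1 - h\<^sup>2)"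
    unfolding power2_norm_eq_inner q_def inner_add_left inner_add_right inner_scaleR_left inner_scaleR_right
    by (simp add: pp pv vp vv power2_eq_square)
  have h2: "0 < h\<^sup>2" "h\<^sup>2 < 1/4" using h power_strict_mono[of h "1/2" 2] by (auto simp: power2_eq_square)
  have "0 \<le> t\<^sup>2 * (1 - h\<^sup>2)" using h2 by (intro mult_nonneg_nonneg) auto
  then have "(norm q)\<^sup>2 > 0" using qq by linarith
  then have "norm q \<noteq> 0" by auto
  then have nq: "norm q > 0" by simp
  \<comment> \<open>After normalisation the signed height of \<open>q\<close> must still exceed
    \<open>h\<close>. Both sides being positive, squares are compared, and their difference splits
    into positive factors.\<close>
  have "(h * norm q)\<^sup>2 < (h + t * (1 - h\<^sup>2))\<^sup>2"
  proof -
    have "(h + t * (1 - h\<^sup>2))\<^sup>2 - (h * norm q)\<^sup>2 = t * (1 - h\<^sup>2) * (2 * h + t * (1 - 2 * h\<^sup>2))"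
      unfolding power_mult_distrib qq by (simp add: power2_eq_square algebra_simps)
    also have "\<dots> > 0" using t h h2 by (intro mult_pos_pos add_pos_pos) auto
    finally show ?thesis by simp
  qed
  then have "h * norm q < h + t * (1 - h\<^sup>2)"
    by (rule power2_less_imp_less) (use t h h2 in auto)
  then have "h < hemi i * (sgn q $ 3)"
    using nq q3 by (simp add: sgn_div_norm field_simps)
  moreover have "sgn q \<in> S2" using nq by (simp add: norm_sgn)
  ultimately show "sgn (p + t *\<^sub>R sgrad (gam Z i) p) \<in> region Z i"
    using i by (simp add: in_region_cap q_def v_def sgrad_gam)
qed simp

lemma linear_cross3: "linear (cross3 w)"
  using bilinear_cross by (auto simp: bilinear_def)

lemma is_psvf_two_circles: "is_psvf r Z"
proof -
  have "smooth_S2 (gam Z i)" for i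
    using Ck_on_affine[OF bounded_linear_gam, of _ UNIV i "- h"]
    unfolding smooth_S2_def smooth_on_def gam_eq by (intro exI[of _ UNIV]) simp
  moreover have "sgrad (gam Z i) p \<noteq> 0" if "p \<in> curve Z i" for i p
  proof
    assume "sgrad (gam Z i) p = 0"
    then have "sgrad (gam Z i) p \<bullet> axis 3 1 = 0" by simp
    then have "hemi i * (1 - (p $ 3)\<^sup>2) = 0"
      by (simp add: sgrad_gam inner_diff_left inner_axis power2_eq_square)
    moreover have "(p $ 3)\<^sup>2 = h\<^sup>2" using that by (auto simp: in_curve hemi_def)
    ultimately have "h\<^sup>2 = 1" by (auto simp: hemi_def split: if_splits)
    then show False using h by (simp add: power2_eq_1_iff)
  qed
  moreover have "simple_smooth_curve (curve Z i)" for i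
    unfolding curve_eq_zone using h by (intro circle_simple_smooth_curve) simp
  moreover have "disjoint_family_on (curve Z) {..<2}"
    using h by (auto simp: disjoint_family_on_def in_curve less_2_cases_iff hemi_def)
  moreover have "Ck_S2 r (cross3 w) \<and> (\<forall>p\<in>S2. p \<bullet> cross3 w p = 0)" for w
    using Ck_on_affine[of "cross3 w" r UNIV 0] linear_cross3[of w]
    unfolding Ck_S2_def by (auto simp: dot_cross_self linear_conv_bounded_linear intro!: exI[of _ UNIV])
  then have "Ck_S2 r (field Z k) \<and> (\<forall>p\<in>S2. p \<bullet> field Z k p = 0)" for k
    by (simp add: two_circles_def)
  moreover have "closure (region Z i) \<inter> closure (region Z 2) = curve Z i" if "i < 2" for i
    using that h
    by (auto simp: in_closure_cap in_closure_band in_curve hemi_def abs_if split: if_splits)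
  ultimately show ?thesis
    using bij_betw_region sgrad_points_into unfolding is_psvf_def by simp
qed

lemma piecewise_linear_two_circles: "piecewise_linear Z"
  unfolding piecewise_linear_def
proof (intro allI impI)
  fix k assume "k \<le> ncurves Z"
  define w where "w = (if k < 2 then cap_axis else band_axis)"
  have "matrix (cross3 w) *v p = cross3 w p" for p
    using matrix_works[of "cross3 w"] linear_cross3[of w] by simp
  then show "\<exists>A :: real^3^3. (\<forall>p\<in>S2. p \<bullet> (A *v p) = 0) \<and> (\<forall>p\<in>S2. field Z k p = A *v p)"
    by (intro exI[of _ "matrix (cross3 w)"]) (simp add: dot_cross_self two_circles_def w_def)
qed

subsection \<open>Transitivity\<close>

lemma rot_axis_3_switching: "p \<in> switching Z \<Longrightarrow> rot (axis 3 1) t p \<in> switching Z"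
  using norm_rot[of "axis 3 1" p t] by (simp add: in_switching rot_axis_3)

text \<open>The orbit never leaves its circle, so sliding lasts over any time interval; this also
  provides the infinite ends of maximal trajectories.\<close>

lemma slide_conc:
  assumes "p \<in> switching Z" "a \<le> b"
  shows "conc Z (\<lambda>u. rot (axis 3 1) (1/2 * u + d) p) a b"
proof (rule conc_single[OF assms(2)])
  have "solution_piece (ZSigma Z) (ZSigma_dom Z) (\<lambda>u. rot (axis 3 1) (1/2 * u + d) p) a b"
    unfolding solution_piece_def
    using ZSigma_switching[OF rot_axis_3_switching[OF assms(1)]]
      rot_has_vector_derivative[of "axis 3 1" "1/2" d p]
    by simp
  then show "local_trajectory Z (\<lambda>u. rot (axis 3 1) (1/2 * u + d) p) a b"
    unfolding local_trajectory_def by blast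
qed

lemma reach_along_curve:
  assumes "p \<in> curve Z i" "q \<in> curve Z i" "i < 2"
  shows "reach Z p q"
proof -
  have pS: "p \<in> switching Z" using assms in_switching_curve by blast
  have z: "p $ 3 = q $ 3" using assms by (simp add: in_curve hemi_mult_eq)
  obtain s where s: "s < 2 * pi" "p = spherical (s, p $ 3)"
    using S2_polar[of p] assms(1) in_curve by blast
  obtain t where t: "0 \<le> t" "q = spherical (t, q $ 3)"
    using S2_polar[of q] assms(2) in_curve by blast
  \<comment> \<open>The full turn makes the angle non-negative, as \<open>s < 2 * pi\<close> and
    \<open>0 \<le> t\<close>.\<close>
  define \<alpha> where "\<alpha> = t - s + 2 * pi"
  have \<alpha>: "0 \<le> \<alpha>" using s t by (simp add: \<alpha>_def)
  have "cos (\<alpha> + s) = cos t" "sin (\<alpha> + s) = sin t" by (simp_all add: \<alpha>_def)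
  then have add: "cos t = cos \<alpha> * cos s - sin \<alpha> * sin s" "sin t = sin \<alpha> * cos s + cos \<alpha> * sin s"
    by (simp_all only: cos_add sin_add)
  then have q: "rot (axis 3 1) \<alpha> p = q"
    by (subst s(2), subst t(2))
       (simp add: vec_eq_iff forall_3 rot_axis_3 spherical_components z add algebra_simps)
  show ?thesis
    unfolding reach_def
  proof
    fix a
    \<comment> \<open>At angular speed 1/2 the angle \<alpha> takes time
      \<open>2 * \<alpha>\<close>; the phase \<open>- a / 2\<close> puts \<open>p\<close> at time
      \<open>a\<close>.\<close>
    have "conc Z (\<lambda>u. rot (axis 3 1) (1/2 * u + (- a / 2)) p) a (a + 2 * \<alpha>)"
      using pS \<alpha> by (intro slide_conc) auto
    then show "\<exists>b x. conc Z x a b \<and> x a = p \<and> x b = q"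
      using q by (intro exI[of _ "a + 2 * \<alpha>"] exI conjI) (assumption, simp_all add: algebra_simps)
  qed
qed

section \<open>Leaving the zones and passing between the circles\<close>

lemma flow_exits:
  fixes g :: "real^3 \<Rightarrow> real"
  assumes w: "norm w = 1" and g: "continuous_on UNIV g"
    and D: "\<And>q. q \<in> S2 \<Longrightarrow> 0 \<le> g q \<Longrightarrow> q \<in> closure (region Z k)"
    and C: "\<And>q. q \<in> S2 \<Longrightarrow> g q = 0 \<Longrightarrow> q \<in> C"
    and p: "p \<in> S2" "0 \<le> g p" and T: "0 \<le> T" "g (rot w (e * T) p) \<le> 0"
  shows "\<exists>t\<in>{0..T}. rot w (e * t) p \<in> C \<and> (\<forall>u\<in>{0..t}. rot w (e * u) p \<in> closure (region Z k))"
proof -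
  have "continuous_on {0..T} (\<lambda>t. g (rot w (e * t) p))"
    by (rule continuous_on_compose2[OF g]) (auto intro!: continuous_intros)
  from first_zero[OF this T(1)] obtain t where t: "t \<in> {0..T}" "g (rot w (e * t) p) = 0"
    "\<forall>u\<in>{0..t}. 0 \<le> g (rot w (e * u) p)"
    using p T by auto
  have "rot w u p \<in> S2" for u using norm_rot[OF w] p by simp
  then show ?thesis using t C D by (intro bexI[of _ t]) auto
qed

text \<open>\<open>g\<close> measures how far a point is inside the zone and vanishes only on the
  circles. It suffices that \<open>g\<close> is not positive at one future time \<open>S\<close> and
  at one past time \<open>- T\<close>: the first zero of \<open>g\<close> on the way is the point
  sought.\<close>

lemma reach_switching:
  fixes g :: "real^3 \<Rightarrow> real"
  assumes w: "norm w = 1" and k: "k \<le> 2" "field Z k = cross3 w" and g: "continuous_on UNIV g"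
    and D: "\<And>q. q \<in> S2 \<Longrightarrow> 0 \<le> g q \<Longrightarrow> q \<in> closure (region Z k)"
    and C: "\<And>q. q \<in> S2 \<Longrightarrow> g q = 0 \<Longrightarrow> q \<in> switching Z"
    and p: "p \<in> S2" "0 \<le> g p"
    and S: "0 \<le> S" "g (rot w S p) \<le> 0" and T: "0 \<le> T" "g (rot w (- T) p) \<le> 0"
  shows "(\<exists>q\<in>switching Z. reach Z p q) \<and> (\<exists>q\<in>switching Z. reach Z q p)"
proof
  have "\<exists>t\<in>{0..S}. rot w (1 * t) p \<in> switching Z
      \<and> (\<forall>u\<in>{0..t}. rot w (1 * u) p \<in> closure (region Z k))"
    by (rule flow_exits[where g = g]) (use assms in \<open>simp_all only: mult_1\<close>)
  then obtain t where t: "t \<in> {0..S}" "rot w t p \<in> switching Z"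
    "\<forall>u\<in>{0..t}. rot w u p \<in> closure (region Z k)"
    unfolding mult_1 by (elim bexE conjE)
  have "reach Z (rot w 0 p) (rot w t p)"
    using t k by (intro reach_flow[OF w, of k]) simp_all
  then show "\<exists>q\<in>switching Z. reach Z p q" using t(2) by auto
  \<comment> \<open>The direction \<open>e = -1\<close> follows the orbit back in time; the segment
    found is then traversed forwards.\<close>
  have "\<exists>s\<in>{0..T}. rot w (- 1 * s) p \<in> switching Z
      \<and> (\<forall>u\<in>{0..s}. rot w (- 1 * u) p \<in> closure (region Z k))"
    by (rule flow_exits[where g = g]) (use assms in \<open>simp_all only: mult_minus1\<close>)
  then obtain s where s: "s \<in> {0..T}" "rot w (- s) p \<in> switching Z"
    "\<forall>u\<in>{0..s}. rot w (- u) p \<in> closure (region Z k)"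
    unfolding mult_minus1 by (elim bexE conjE)
  have "reach Z (rot w (- s) p) (rot w 0 p)"
  proof (rule reach_flow[OF w, of k])
    show "rot w u p \<in> closure (region Z k)" if "- s \<le> u" "u \<le> 0" for u
      using bspec[OF s(3), of "- u"] that by simp
  qed (use s k in simp_all)
  then show "\<exists>q\<in>switching Z. reach Z q p" using s(2) by auto
qed

lemma cap_reach_switching:
  assumes i: "i < 2" and p: "p \<in> closure (region Z i)"
  shows "(\<exists>q\<in>switching Z. reach Z p q) \<and> (\<exists>q\<in>switching Z. reach Z q p)"
\<comment> \<open>A half turn about a horizontal axis negates the height, so in either direction the
  orbit is outside the cap after time \<open>pi\<close>.\<close>
proof (rule reach_switching[where w = cap_axis and k = i and g = "\<lambda>q. hemi i * q $ 3 - h" and S = pi and T = pi])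
  show "q \<in> switching Z" if "q \<in> S2" "hemi i * q $ 3 - h = 0" for q
    unfolding in_switching_curve using that i in_curve by auto
qed (use i p h in \<open>auto simp: norm_axes in_closure_cap rot_3 axis_components intro!: continuous_intros\<close>)

text \<open>Along an orbit in the band the height oscillates with amplitude \<open>\<bar>r\<bar>\<close> around \<open>4/5 * k\<close>, where
  \<open>k = band_axis \<bullet> p\<close> and \<open>r\<^sup>2 = 9/25 * (1 - k\<^sup>2)\<close>; hence its modulus reaches \<open>4/5 * \<bar>k\<bar> + \<bar>r\<bar> \<ge> 3/5\<close>.\<close>

lemma band_orbit_leaves:
  assumes "p \<in> S2"
  shows "\<exists>t. 0 \<le> t \<and> t < 2 * pi \<and> h \<le> \<bar>rot band_axis t p $ 3\<bar>"
proof -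
  define k where "k = band_axis \<bullet> p"
  obtain r a where ra: "p $ 3 - 4/5 * k = r * cos a" "3/5 * p $ 2 = r * sin a"
    using polar_Ex by metis
  have height: "rot band_axis t p $ 3 = 4/5 * k + r * cos (t - a)" for t
  proof -
    have "rot band_axis t p $ 3 = 4/5 * k + cos t * (p $ 3 - 4/5 * k) + sin t * (3/5 * p $ 2)"
      by (simp add: rot_3 axis_components k_def algebra_simps)
    then show ?thesis unfolding ra by (simp add: cos_diff algebra_simps)
  qed
  have "r\<^sup>2 = (p $ 3 - 4/5 * k)\<^sup>2 + (3/5 * p $ 2)\<^sup>2"
    unfolding ra using sin_cos_squared_add[of a] by algebra
  also have "\<dots> = 9/25 * (1 - k\<^sup>2)"
  proof -
    have "(p $ 1)\<^sup>2 + (p $ 2)\<^sup>2 + (p $ 3)\<^sup>2 = 1" using assms by (simp add: norm_1_coords)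
    then show ?thesis unfolding k_def inner_band_axis by algebra
  qed
  finally have r: "r\<^sup>2 = 9/25 * (1 - k\<^sup>2)" .
  \<comment> \<open>Substituting \<open>r\<^sup>2\<close>, the right side is
    \<open>9/25 + 7/25 * k\<^sup>2\<close> plus a non-negative mixed term.\<close>
  have "(3/5)\<^sup>2 \<le> (4/5 * \<bar>k\<bar> + \<bar>r\<bar>)\<^sup>2"
  proof -
    define K R where "K = \<bar>k\<bar>" and "R = \<bar>r\<bar>"
    have "R\<^sup>2 = 9/25 * (1 - K\<^sup>2)" using r by (simp add: K_def R_def)
    moreover have "(4/5 * K + R)\<^sup>2 = 16/25 * K\<^sup>2 + R\<^sup>2 + 8/5 * (K * R)"
      by (simp add: power2_eq_square algebra_simps)
    moreover have "0 \<le> K * R" "0 \<le> K\<^sup>2" by (simp_all add: K_def R_def)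
    moreover have "(3/5 :: real)\<^sup>2 = 9/25" by (simp add: power2_eq_square)
    ultimately show ?thesis unfolding K_def[symmetric] R_def[symmetric] by argo
  qed
  then have "3/5 \<le> 4/5 * \<bar>k\<bar> + \<bar>r\<bar>" by (rule power2_le_imp_le) simp
  \<comment> \<open>The extreme heights are \<open>4/5 * k + r\<close> and
    \<open>4/5 * k - r\<close>, taken at the angles \<open>a\<close> and \<open>a + pi\<close>; the
    larger of their moduli is \<open>4/5 * \<bar>k\<bar> + \<bar>r\<bar>\<close>.\<close>
  then have "h \<le> \<bar>4/5 * k + r\<bar> \<or> h \<le> \<bar>4/5 * k - r\<bar>" using h by linarith
  moreover have "rot band_axis a p $ 3 = 4/5 * k + r" "rot band_axis (a + pi) p $ 3 = 4/5 * k - r"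
    by (simp_all add: height)
  ultimately obtain b where b: "h \<le> \<bar>rot band_axis b p $ 3\<bar>" by metis
  obtain t where t: "0 \<le> t" "t < 2 * pi" "cos b = cos t" "sin b = sin t"
    using sincos_total_2pi[of "cos b" "sin b"] by auto
  have "rot band_axis t p = rot band_axis b p" by (simp add: rot_def t)
  then show ?thesis using b t by metis
qed

lemma band_reach_switching:
  assumes p: "p \<in> closure (region Z 2)"
  shows "(\<exists>q\<in>switching Z. reach Z p q) \<and> (\<exists>q\<in>switching Z. reach Z q p)"
proof -
  obtain t where t: "0 \<le> t" "t < 2 * pi" "h \<le> \<bar>rot band_axis t p $ 3\<bar>"
    using band_orbit_leaves p in_closure_band by blast
  \<comment> \<open>By periodicity the same exit point is met after turning back by
    \<open>2 * pi - t\<close>, so one angle serves both directions.\<close>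
  have "rot band_axis (- (2 * pi - t)) p = rot band_axis t p"
    by (simp add: rot_def cos_diff sin_diff)
  then have leaves: "h - \<bar>rot band_axis (- (2 * pi - t)) p $ 3\<bar> \<le> 0" using t(3) by simp
  show ?thesis
  proof (rule reach_switching[where w = band_axis and k = 2 and g = "\<lambda>q. h - \<bar>q $ 3\<bar>"
        and S = t and T = "2 * pi - t"])
    show "q \<in> switching Z" if "q \<in> S2" "h - \<bar>q $ 3\<bar> = 0" for q
      unfolding in_switching using that by auto
  qed (use p t leaves in \<open>auto simp: norm_axes in_closure_band intro!: continuous_intros\<close>)
qed

lemma reach_other_curve:
  assumes "i < 2" "j < 2" "i \<noteq> j"
  shows "\<exists>p\<in>curve Z i. \<exists>q\<in>curve Z j. reach Z p q"
proof -
  \<comment> \<open>A point of circle \<open>i\<close> in the plane perpendicular to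
    \<open>band_axis\<close>: \<open>3 * x + 4 * z = 0\<close> gives \<open>x\<close>, the unit norm
    gives \<open>y\<close> up to sign, and the sign is chosen so that the orbit enters the band. As
    the orbit is a great circle, half a turn ends at the antipode, on the other parallel.\<close>
  define p :: "real^3" where
    "p = hemi i *\<^sub>R (- (4/3 * h) *\<^sub>R axis 1 1 - sqrt (1 - 25/9 * h\<^sup>2) *\<^sub>R axis 2 1 + h *\<^sub>R axis 3 1)"
  have pc: "p $ 1 = - (hemi i * (4/3 * h))" "p $ 2 = - (hemi i * sqrt (1 - 25/9 * h\<^sup>2))"
    "p $ 3 = hemi i * h"
    by (simp_all add: p_def axis_def)
  have "h\<^sup>2 \<le> (1/2)\<^sup>2" using h by (intro power_mono) auto
  then have h2: "0 \<le> 1 - 25/9 * h\<^sup>2" by (simp add: power2_eq_square)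
  have s: "(hemi i)\<^sup>2 = 1" by (simp add: power2_eq_square)
  have "norm p = 1"
    unfolding norm_1_coords pc using h2 s
    by (simp add: power_mult_distrib) (simp add: power2_eq_square)
  then have pS: "p \<in> S2" by simp
  have k: "band_axis \<bullet> p = 0" by (simp add: inner_band_axis pc)
  have height: "hemi i * rot band_axis u p $ 3 = h * cos u - 3/5 * sqrt (1 - 25/9 * h\<^sup>2) * sin u" for u
    by (simp add: rot_3 axis_components k pc algebra_simps)
  have hj: "hemi j = - hemi i" using assms by (auto simp: hemi_def less_2_cases_iff)
  have "continuous_on {0..pi} (\<lambda>u. hemi i * rot band_axis u p $ 3 + h)"
    by (intro continuous_intros)
  moreover have "0 \<le> hemi i * rot band_axis 0 p $ 3 + h" "hemi i * rot band_axis pi p $ 3 + h \<le> 0"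
    unfolding height using h by simp_all
  ultimately obtain t where t: "t \<in> {0..pi}" "hemi i * rot band_axis t p $ 3 + h = 0"
    "\<And>u. u \<in> {0..t} \<Longrightarrow> 0 \<le> hemi i * rot band_axis u p $ 3 + h"
    using first_zero[of pi "\<lambda>u. hemi i * rot band_axis u p $ 3 + h"] by auto
  have rS: "rot band_axis u p \<in> S2" for u using norm_rot[OF norm_axes(2)] pS by simp
  have "reach Z (rot band_axis 0 p) (rot band_axis t p)"
  proof (rule reach_flow[OF norm_axes(2), of 2])
    fix u assume u: "0 \<le> u" "u \<le> t"
    \<comment> \<open>The sine term only lowers the signed height during the first half turn, so the
      orbit does not return above the circle it started from.\<close>
    have "hemi i * rot band_axis u p $ 3 \<le> h"
    proof -
      have "h * cos u \<le> h * 1" using h by (intro mult_left_mono) auto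
      moreover have "0 \<le> 3/5 * sqrt (1 - 25/9 * h\<^sup>2) * sin u"
        using u t(1) h2 by (intro mult_nonneg_nonneg sin_ge_zero) auto
      ultimately show ?thesis unfolding height by linarith
    qed
    moreover have "- h \<le> hemi i * rot band_axis u p $ 3" using t(3)[of u] u by simp
    ultimately have "\<bar>hemi i * rot band_axis u p $ 3\<bar> \<le> h" by linarith
    then show "rot band_axis u p \<in> closure (region Z 2)"
      using rS unfolding abs_hemi by (simp add: in_closure_band)
  qed (use t in auto)
  moreover have "p \<in> curve Z i" using pS by (simp add: in_curve pc)
  moreover have "rot band_axis t p \<in> curve Z j" using rS t(2) by (simp add: in_curve hj)
  ultimately show ?thesis by auto
qed

section \<open>Joining arbitrary points by maximal trajectories\<close>

lemma reach_within_switching: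
  assumes "p \<in> switching Z" "q \<in> switching Z"
  shows "reach Z p q"
proof -
  obtain i j where i: "i < 2" "p \<in> curve Z i" and j: "j < 2" "q \<in> curve Z j"
    using assms in_switching_curve by blast
  show ?thesis
  proof (cases "i = j")
    case True
    then show ?thesis using i j reach_along_curve by blast
  next
    case False
    then obtain p' q' where "p' \<in> curve Z i" "q' \<in> curve Z j" "reach Z p' q'"
      using reach_other_curve i j by blast
    then show ?thesis using i j reach_along_curve reach_trans by metis
  qed
qed

lemma reach_switching_from_anywhere:
  assumes "p \<in> S2"
  shows "(\<exists>q\<in>switching Z. reach Z p q) \<and> (\<exists>q\<in>switching Z. reach Z q p)"
proof -
  have "p \<in> closure (region Z 0) \<or> p \<in> closure (region Z 1) \<or> p \<in> closure (region Z 2)"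
    using assms by (auto simp: in_closure_cap in_closure_band hemi_def)
  then show ?thesis using cap_reach_switching[of 0] cap_reach_switching[of 1] band_reach_switching by auto
qed

lemma reach_everywhere:
  assumes "p \<in> S2" "q \<in> S2"
  shows "reach Z p q"
proof -
  obtain p' q' where "p' \<in> switching Z" "reach Z p p'" "q' \<in> switching Z" "reach Z q' q"
    using reach_switching_from_anywhere assms by meson
  then show ?thesis using reach_within_switching reach_trans by metis
qed

text \<open>The strict inequality excludes the empty concatenation, which says nothing about the
  value of \<open>x\<close>.\<close>

lemma conc_in_S2:
  assumes "conc Z x a b" "a < b" "u \<in> {a..b}"
  shows "x u \<in> S2"
proof -
  have loc: "x u \<in> S2" if "local_trajectory Z x s t" "u \<in> {s..t}" for s t
  proof -
    have "closure (region Z k) \<subseteq> S2" for k by (auto simp: closure_region zone_def)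
    moreover have "ZSigma_dom Z \<subseteq> S2"
      using sliding_escaping tangency_iff in_switching
      unfolding ZSigma_dom_def extends_to_def by blast
    ultimately show ?thesis
      using that unfolding local_trajectory_def solution_piece_def by blast
  qed
  from assms show ?thesis
  proof (induction rule: conc.induct)
    case (conc_step b c)
    show ?case
    proof (cases "b \<le> u")
      case True
      then show ?thesis using loc[OF conc_step.hyps(3)] conc_step.prems by auto
    next
      case False
      then show ?thesis using conc_step by auto
    qed
  qed simp
qed

text \<open>Sliding along a switching circle for all negative and for all large positive times makes the
  trajectory defined on the whole time line, hence maximal.\<close>

lemma filippov_trajectory_through:
  assumes "p \<in> S2" "q \<in> S2"
  shows "\<exists>x s t. filippov_trajectory Z UNIV x \<and> x s = p \<and> x t = q"
proof -
  \<comment> \<open>The finite part of the trajectory runs from \<open>c\<close> through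
    \<open>p\<close> and \<open>q\<close> to \<open>d\<close>, with both ends on the
    circles.\<close>
  obtain c d where c: "c \<in> switching Z" "reach Z c p" and d: "d \<in> switching Z" "reach Z q d"
    using reach_switching_from_anywhere assms by meson
  obtain t1 x1 where x1: "conc Z x1 0 t1" "x1 0 = c" "x1 t1 = p"
    using c(2)[unfolded reach_def, THEN spec, of 0] by (elim exE conjE)
  obtain t2 x2 where x2: "conc Z x2 t1 t2" "x2 t1 = p" "x2 t2 = q"
    using reach_everywhere[OF assms, unfolded reach_def, THEN spec, of t1] by (elim exE conjE)
  obtain t3 x3 where x3: "conc Z x3 t2 t3" "x3 t2 = q" "x3 t3 = d"
    using d(2)[unfolded reach_def, THEN spec, of t2] by (elim exE conjE)
  have t: "0 \<le> t1" "t1 \<le> t2" "t2 \<le> t3" using x1 x2 x3 conc_le by blast+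
  define x0 where "x0 = (\<lambda>u. rot (axis 3 1) (1/2 * u + 0) c)"
  \<comment> \<open>The phase makes the final sliding motion start in \<open>d\<close> at time
    \<open>t3\<close>.\<close>
  define x4 where "x4 = (\<lambda>u. rot (axis 3 1) (1/2 * u + (- t3 / 2)) d)"
  have x0: "conc Z x0 a 0" if "a \<le> 0" for a
    unfolding x0_def by (rule slide_conc[OF c(1) that])
  have x4: "conc Z x4 t3 b" if "t3 \<le> b" for b
    unfolding x4_def by (rule slide_conc[OF d(1) that])
  have x04: "x0 0 = c" "x4 t3 = d" by (simp_all add: x0_def x4_def)
  define y1 where "y1 = glue 0 x0 x1"
  define y2 where "y2 = glue t1 y1 x2"
  define y3 where "y3 = glue t2 y2 x3"
  define y where "y = glue t3 y3 x4"
  have y1: "y1 t1 = p" using t x1 x04 by (simp add: y1_def glue_right)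
  have y2: "y2 t1 = p" "y2 t2 = q" using t x2 y1 by (simp_all add: y2_def glue_left glue_right)
  have y3: "y3 t1 = p" "y3 t2 = q" "y3 t3 = d"
    using t x3 y2 by (simp_all add: y3_def glue_left glue_right)
  have y: "y t1 = p" "y t2 = q" using t y3 by (simp_all add: y_def glue_left)
  have wide: "conc Z y a b" if ab: "a \<le> 0" "t3 \<le> b" for a b
  proof -
    have "conc Z y1 a t1" unfolding y1_def by (rule conc_glue[OF x0[OF ab(1)] x1(1)]) (simp add: x1 x04)
    then have "conc Z y2 a t2" unfolding y2_def by (rule conc_glue[OF _ x2(1)]) (simp add: y1 x2)
    then have "conc Z y3 a t3" unfolding y3_def by (rule conc_glue[OF _ x3(1)]) (simp add: y2 x3)
    then show ?thesis unfolding y_def by (rule conc_glue[OF _ x4[OF ab(2)]]) (simp add: y3 x04)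
  qed
  \<comment> \<open>Any time interval lies in one that contains the whole finite part, so
    restriction suffices.\<close>
  have conc: "conc Z y a b" if "a < b" for a b
    by (rule conc_subinterval[OF wide[of "min a 0" "max b t3"]]) (use that in auto)
  have "range y \<subseteq> S2" using conc_in_S2[OF conc] by (metis atLeastAtMost_iff image_subsetI lt_ex less_imp_le order_refl)
  then have "filippov_trajectory Z UNIV y" using conc by (intro filippov_trajectory_UNIV)
  then show ?thesis using y by blast
qed

lemma transitive_two_circles: "transitive Z"
  unfolding transitive_def
proof (intro allI impI, elim conjE)
  fix U V :: "(real^3) set"
  assume U: "openin (top_of_set S2) U" "U \<noteq> {}" and V: "openin (top_of_set S2) V" "V \<noteq> {}"
  then obtain p q where "p \<in> U" "q \<in> V" by blast
  moreover from this have "p \<in> S2" "q \<in> S2" using U(1) V(1) openin_imp_subset by blast+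
  ultimately show "\<exists>T x. filippov_trajectory Z T x \<and> (\<exists>s\<in>T. x s \<in> U) \<and> (\<exists>t\<in>T. x t \<in> V)"
    using filippov_trajectory_through by (metis UNIV_I)
qed

end

theorem theorem1:
  fixes r :: nat
  shows "\<exists>(I :: real set) (Z :: real \<Rightarrow> psvf).
    one_parameter_family r I Z \<and> (\<forall>\<theta>\<in>I. piecewise_linear (Z \<theta>) \<and> transitive (Z \<theta>))"
proof (intro exI conjI ballI)
  have loc: "half_height h" if "h \<in> {0<..<1/2}" for h
    using that by (auto simp: half_height_def)
  show "piecewise_linear (two_circles h)" "transitive (two_circles h)" if "h \<in> {0<..<1/2}" for h
    using half_height.piecewise_linear_two_circles half_height.transitive_two_circles loc that by blast+
  have "\<not> same_psvf (two_circles h) (two_circles h')"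
    if "h \<in> {0<..<1/2}" "h' \<in> {0<..<1/2}" "h \<noteq> h'" for h h'
  proof
    assume "same_psvf (two_circles h) (two_circles h')"
    then have eq: "switching (two_circles h) = switching (two_circles h')" by (simp add: same_psvf_def)
    \<comment> \<open>Different parameters already give different switching sets: a point at height
      \<open>h\<close> belongs to only one of them.\<close>
    define p where "p = spherical (0, h)"
    have p: "p \<in> S2" "p $ 3 = h"
      using spherical_in_S2[of "(0, h)"] that(1) by (simp_all add: p_def spherical_components)
    then have "p \<in> switching (two_circles h)"
      using that(1) half_height.in_switching[OF loc] by simp
    then have "\<bar>p $ 3\<bar> = h'"
      using eq half_height.in_switching[OF loc[OF that(2)]] by blast
    then show False using p that by simp
  qed
  moreover have "\<exists>a\<in>{0<..<1/2}. \<exists>b\<in>{0<..<1/2}. a < (b :: real)"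
    by (rule bexI[of _ "1/4"], rule bexI[of _ "1/3"]) auto
  moreover have "is_interval {0<..<1/2 :: real}" by simp
  ultimately show "one_parameter_family r {0<..<1/2} two_circles"
    using half_height.is_psvf_two_circles loc unfolding one_parameter_family_def by blast
qed

end
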